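(* Assume that the discrete Fourier pseudo-spectral Laplacian $\Delta_h$ on the periodic grid satisfies $(\Delta_hV,\mathbf 1)_h=0$ for all $V\in V_h$. Then both the isotropic AIQ scheme and the anisotropic AIQ scheme (defined in the context) preserve the discrete mass: $$(U^{n+1},\mathbf 1)_h=(U^n,\mathbf 1)_h.$$
   Context: $V_h$ is the space of real grid functions (matrices) $U=\{U_{jk}\}$ on a uniform periodic rectangular grid with mesh sizes $h_x,h_y$. $(U,V)_h=h_xh_y\sum_{j,k}U_{jk}V_{jk}$, and $\mathbf 1$ is the grid function identically $1$. $D_x,D_y$ are the first-order Fourier pseudo-spectral differentiation matrices, $\Delta_hU=D_x^2U+U(D_y^\top)^2$, $\odot$ is the entrywise product, and $U^{\odot2}=U\odot U$. The Runge–Kutta coefficients satisfy $b_ia_{ij}+b_ja_{ji}-b_ib_j=0$, $1\le i,j\le s$. $\Delta t>0$, $\varepsilon>0$, $\beta\ge0$. In all relations below $i=1,\dots,s$. Isotropic AIQ scheme: $U_i=U^n+\Delta t\sum_j a_{ij}K_j$, $Q_i=Q^n+\Delta t\sum_j a_{ij}L_j$, $K_i=\Delta_h\mu_i$, $\mu_i=-\Delta_hU_i+2\varepsilon^{-2}U_i\odot Q_i+\beta\Delta_h^2U_i$, $L_i=U_i\odot K_i$, $U^{n+1}=U^n+\Delta t\sum_i b_iK_i$, $Q^{n+1}=Q^n+\Delta t\sum_i b_iL_i$. Anisotropic AIQ scheme: the unknowns are $U$ and auxiliary grid functions $Y_1,\dots,Y_6,Z_1,Z_2,\Phi_1$. The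 stages are $U_i=U^n+\Delta t\sum_ja_{ij}K_j$, $Y_{\ell,i}=Y_\ell^n+\Delta t\sum_ja_{ij}P_{\ell,j}$, $Z_{\ell,i}=Z_\ell^n+\Delta t\sum_ja_{ij}R_{\ell,j}$, $\Phi_{1,i}=\Phi_1^n+\Delta t\sum_ja_{ij}S_{1,j}$. The updates are $U^{n+1}=U^n+\Delta t\sum_ib_iK_i$, $Y_\ell^{n+1}=Y_\ell^n+\Delta t\sum_ib_iP_{\ell,i}$, $Z_\ell^{n+1}=Z_\ell^n+\Delta t\sum_ib_iR_{\ell,i}$, $\Phi_1^{n+1}=\Phi_1^n+\Delta t\sum_ib_iS_{1,i}$. The stage derivatives are, with subscripts $x,y$ denoting application of $D_x$ (from the left) and $D_y^\top$ (from the right), $K_i=\Delta_h\mu_i$, $P_{1,i}=2U_{x,i}\odot K_{x,i}$, $P_{2,i}=2U_{y,i}\odot K_{y,i}$, $P_{3,i}=2(Y_{1,i}+Y_{2,i})\odot(P_{1,i}+P_{2,i})$, $P_{4,i}=-Y_{4,i}^{\odot2}\odot P_{3,i}$, $P_{5,i}=2Y_{1,i}\odot P_{1,i}+2Y_{2,i}\odot P_{2,i}$, $P_{6,i}=Y_{4,i}\odot P_{5,i}+Y_{5,i}\odot P_{4,i}$, $R_{1,i}=U_i\odot K_i$, $R_{2,i}=2Z_{1,i}\odot R_{1,i}$, $S_{1,i}=2\Delta_hU_i\odot\Delta_hK_i$. Here $\mu_i\in V_h$ is the anisotropic stage chemical potential, a grid function determined by the stage values; its specific form is not used in the statement, only that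 $\mu_i\in V_h$ and $K_i=\Delta_h\mu_i$. *)

theory Defs
  imports "HOL-Analysis.Analysis"
begin

text \<open>
  A grid function \<open>U\<close> has entries \<open>U $ j $ k\<close>, with \<open>j\<close> the index in the \<open>x\<close>-direction and \<open>k\<close> the
  index in the \<open>y\<close>-direction.  On this type the operations \<open>*\<close> and \<open>1\<close> of HOL-Analysis act entrywise:
  \<open>*\<close> is the Hadamard product and \<open>1\<close> is the grid function that is identically one.  The matrix
  product is \<open>**\<close>.
\<close>

type_synonym ('x, 'y) grid = "real ^ 'y ^ 'x"

definition grid_inner :: "real \<Rightarrow> real \<Rightarrow> ('x::finite, 'y::finite) grid \<Rightarrow> ('x, 'y) grid \<Rightarrow> real" where
  "grid_inner hx hy U V = hx * hy * (\<Sum>j\<in>UNIV. \<Sum>k\<in>UNIV. U $ j $ k * V $ j $ k)"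

text \<open>The order of the index type numbers the nodes of a one-dimensional grid by \<open>0, \<dots>, N - 1\<close>.\<close>

definition node_number :: "'n::{finite,linorder} \<Rightarrow> nat" where
  "node_number j = card {i. i < j}"

text \<open>
  The cardinal function, belonging to the node \<open>m h\<close>, of trigonometric interpolation on the grid
  \<open>0, h, \<dots>, (N - 1) h\<close> with period \<open>N h\<close>.  It is
  \<open>(1/N) \<Sum>\<^bsub>\<bar>l\<bar> \<le> N/2\<^esub> (1/c\<^sub>l) exp (2 \<pi> \<i> l (x - m h) / (N h))\<close>,
  where \<open>c\<^sub>l = 2\<close> for the two modes \<open>l = \<plusminus>N/2\<close> (present only for even \<open>N\<close>) and \<open>c\<^sub>l = 1\<close>
  otherwise; the imaginary parts of the modes \<open>l\<close> and \<open>-l\<close> cancel.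
\<close>

definition fourier_cardinal :: "nat \<Rightarrow> real \<Rightarrow> nat \<Rightarrow> real \<Rightarrow> real" where
  "fourier_cardinal N h m x =
     (\<Sum>l \<in> {l::int. 2 * \<bar>l\<bar> \<le> int N}.
        (if 2 * \<bar>l\<bar> = int N then 1 / 2 else 1)
          * cos (2 * pi * of_int l * (x - real m * h) / (real N * h))) / real N"

text \<open>
  The differentiation matrix maps nodal values to the nodal values of the derivative of the
  trigonometric interpolant.
\<close>

definition fourier_diff :: "real \<Rightarrow> real ^ ('n::{finite,linorder}) ^ ('n::{finite,linorder})" where
  "fourier_diff h =
     (\<chi> j k. deriv (fourier_cardinal CARD('n) h (node_number k)) (real (node_number j) * h))"

definition grid_dx ::
  "real \<Rightarrow> ('x::{finite,linorder}, 'y::{finite,linorder}) grid \<Rightarrow> ('x, 'y) grid" where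
  "grid_dx hx U = fourier_diff hx ** U"

definition grid_dy ::
  "real \<Rightarrow> ('x::{finite,linorder}, 'y::{finite,linorder}) grid \<Rightarrow> ('x, 'y) grid" where
  "grid_dy hy U = U ** transpose (fourier_diff hy)"

definition grid_laplacian ::
  "real \<Rightarrow> real \<Rightarrow> ('x::{finite,linorder}, 'y::{finite,linorder}) grid \<Rightarrow> ('x, 'y) grid" where
  "grid_laplacian hx hy U =
     (fourier_diff hx ** fourier_diff hx) ** U
     + U ** (transpose (fourier_diff hy) ** transpose (fourier_diff hy))"

definition symplectic_tableau :: "nat \<Rightarrow> (nat \<Rightarrow> nat \<Rightarrow> real) \<Rightarrow> (nat \<Rightarrow> real) \<Rightarrow> bool" where
  "symplectic_tableau s a b \<longleftrightarrow>
     (\<forall>i\<in>{1..s}. \<forall>j\<in>{1..s}. b i * a i j + b j * a j i - b i * b j = 0)"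

definition rk_stages ::
  "nat \<Rightarrow> (nat \<Rightarrow> nat \<Rightarrow> real) \<Rightarrow> real \<Rightarrow> 'v::real_vector \<Rightarrow> (nat \<Rightarrow> 'v) \<Rightarrow> (nat \<Rightarrow> 'v) \<Rightarrow> bool" where
  "rk_stages s a dt vold v k \<longleftrightarrow> (\<forall>i\<in>{1..s}. v i = vold + dt *\<^sub>R (\<Sum>j=1..s. a i j *\<^sub>R k j))"

definition rk_update ::
  "nat \<Rightarrow> (nat \<Rightarrow> real) \<Rightarrow> real \<Rightarrow> 'v::real_vector \<Rightarrow> (nat \<Rightarrow> 'v) \<Rightarrow> 'v \<Rightarrow> bool" where
  "rk_update s b dt vold k vnew \<longleftrightarrow> vnew = vold + dt *\<^sub>R (\<Sum>i=1..s. b i *\<^sub>R k i)"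

text \<open>
  The schemes are implicit, so one step is a relation between the old and the new values: the stage
  equations have a solution from which the new values are computed.
\<close>

definition isotropic_AIQ_step ::
  "real \<Rightarrow> real \<Rightarrow> nat \<Rightarrow> (nat \<Rightarrow> nat \<Rightarrow> real) \<Rightarrow> (nat \<Rightarrow> real) \<Rightarrow> real \<Rightarrow> real \<Rightarrow> real
   \<Rightarrow> ('x::{finite,linorder}, 'y::{finite,linorder}) grid \<Rightarrow> ('x, 'y) grid
   \<Rightarrow> ('x, 'y) grid \<Rightarrow> ('x, 'y) grid \<Rightarrow> bool" where
  "isotropic_AIQ_step hx hy s a b dt \<epsilon> \<beta> Uold Qold Unew Qnew \<longleftrightarrow>
     (\<exists>U Q K L \<mu>.
        rk_stages s a dt Uold U K \<and> rk_stages s a dt Qold Q L \<and>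
        (\<forall>i\<in>{1..s}.
           K i = grid_laplacian hx hy (\<mu> i) \<and>
           \<mu> i = - grid_laplacian hx hy (U i) + (2 / \<epsilon>\<^sup>2) *\<^sub>R (U i * Q i)
                 + \<beta> *\<^sub>R grid_laplacian hx hy (grid_laplacian hx hy (U i)) \<and>
           L i = U i * K i) \<and>
        rk_update s b dt Uold K Unew \<and> rk_update s b dt Qold L Qnew)"

text \<open>
  \<open>Yold l\<close> and \<open>Ynew l\<close> (\<open>l = 1, \<dots>, 6\<close>) and \<open>Zold l\<close> and \<open>Znew l\<close> (\<open>l = 1, 2\<close>) are the auxiliary grid
  functions; \<open>Y l i\<close> and \<open>Z l i\<close> are their values at stage \<open>i\<close>.  The argument \<open>chem\<close> gives the
  anisotropic chemical potential as a function of the stage values of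
  \<open>U, Y\<^sub>1, \<dots>, Y\<^sub>6, Z\<^sub>1, Z\<^sub>2, \<Phi>\<^sub>1\<close>.
\<close>

type_synonym ('x, 'y) chem_potential =
  "('x, 'y) grid
   \<Rightarrow> ('x, 'y) grid \<Rightarrow> ('x, 'y) grid \<Rightarrow> ('x, 'y) grid \<Rightarrow> ('x, 'y) grid \<Rightarrow> ('x, 'y) grid \<Rightarrow> ('x, 'y) grid
   \<Rightarrow> ('x, 'y) grid \<Rightarrow> ('x, 'y) grid \<Rightarrow> ('x, 'y) grid \<Rightarrow> ('x, 'y) grid"

definition anisotropic_AIQ_step ::
  "real \<Rightarrow> real \<Rightarrow> nat \<Rightarrow> (nat \<Rightarrow> nat \<Rightarrow> real) \<Rightarrow> (nat \<Rightarrow> real) \<Rightarrow> real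
   \<Rightarrow> ('x::{finite,linorder}, 'y::{finite,linorder}) chem_potential
   \<Rightarrow> ('x, 'y) grid \<Rightarrow> (nat \<Rightarrow> ('x, 'y) grid) \<Rightarrow> (nat \<Rightarrow> ('x, 'y) grid) \<Rightarrow> ('x, 'y) grid
   \<Rightarrow> ('x, 'y) grid \<Rightarrow> (nat \<Rightarrow> ('x, 'y) grid) \<Rightarrow> (nat \<Rightarrow> ('x, 'y) grid) \<Rightarrow> ('x, 'y) grid \<Rightarrow> bool" where
  "anisotropic_AIQ_step hx hy s a b dt chem Uold Yold Zold \<Phi>old Unew Ynew Znew \<Phi>new \<longleftrightarrow>
     (\<exists>U Y Z \<Phi> K P R S \<mu>.
        rk_stages s a dt Uold U K \<and>
        (\<forall>l\<in>{1..6}. rk_stages s a dt (Yold l) (Y l) (P l)) \<and>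
        (\<forall>l\<in>{1..2}. rk_stages s a dt (Zold l) (Z l) (R l)) \<and>
        rk_stages s a dt \<Phi>old \<Phi> S \<and>
        (\<forall>i\<in>{1..s}.
           \<mu> i = chem (U i) (Y 1 i) (Y 2 i) (Y 3 i) (Y 4 i) (Y 5 i) (Y 6 i) (Z 1 i) (Z 2 i) (\<Phi> i) \<and>
           K i = grid_laplacian hx hy (\<mu> i) \<and>
           P 1 i = 2 *\<^sub>R (grid_dx hx (U i) * grid_dx hx (K i)) \<and>
           P 2 i = 2 *\<^sub>R (grid_dy hy (U i) * grid_dy hy (K i)) \<and>
           P 3 i = 2 *\<^sub>R ((Y 1 i + Y 2 i) * (P 1 i + P 2 i)) \<and>
           P 4 i = - ((Y 4 i * Y 4 i) * P 3 i) \<and>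
           P 5 i = 2 *\<^sub>R (Y 1 i * P 1 i) + 2 *\<^sub>R (Y 2 i * P 2 i) \<and>
           P 6 i = Y 4 i * P 5 i + Y 5 i * P 4 i \<and>
           R 1 i = U i * K i \<and>
           R 2 i = 2 *\<^sub>R (Z 1 i * R 1 i) \<and>
           S i = 2 *\<^sub>R (grid_laplacian hx hy (U i) * grid_laplacian hx hy (K i))) \<and>
        rk_update s b dt Uold K Unew \<and>
        (\<forall>l\<in>{1..6}. rk_update s b dt (Yold l) (P l) (Ynew l)) \<and>
        (\<forall>l\<in>{1..2}. rk_update s b dt (Zold l) (R l) (Znew l)) \<and>
        rk_update s b dt \<Phi>old S \<Phi>new)"

end

theory Submission
  imports Defs
begin

text \<open>
  The discrete mass \<open>U \<mapsto> (U, \<one>)\<^sub>h\<close> is a linear functional, and a Runge--Kutta update adds to the old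
  value a linear combination of the stage derivatives.  In both schemes every stage derivative of
  \<open>U\<close> is a discrete Laplacian \<open>\<Delta>\<^sub>h \<mu>\<^sub>i\<close>, so that the mass functional vanishes on it; hence the
  increment has mass zero.  The argument, \<open>rk_update_linear_invariant\<close> applied to the mass
  functional, is the same for both schemes.
\<close>

lemma linear_grid_inner_left: "linear (\<lambda>U. grid_inner hx hy U V)"
  by (rule linearI)
     (simp_all add: grid_inner_def sum.distrib sum_distrib_left algebra_simps)

text \<open>
  A linear functional \<open>f\<close> turns the update into the scalar update with stage derivatives
  \<open>f (k i)\<close>; this is why Runge--Kutta methods preserve the linear invariants of a system.
\<close>

lemma rk_update_linear_invariant:
  assumes "linear f"
    and "rk_update s b dt vold k vnew"
    and "\<And>i. i \<in> {1..s} \<Longrightarrow> f (k i) = 0"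
  shows "f vnew = f vold"
proof -
  interpret linear f by fact
  show ?thesis
    using assms(2,3) by (simp add: rk_update_def add scale sum)
qed

theorem proposition5:
  fixes hx hy dt \<epsilon> \<beta> :: real
    and s :: nat and a :: "nat \<Rightarrow> nat \<Rightarrow> real" and b :: "nat \<Rightarrow> real"
  assumes "hx > 0" and "hy > 0" and "dt > 0" and "\<epsilon> > 0" and "\<beta> \<ge> 0"
    and "s \<ge> 1" and "symplectic_tableau s a b"
    and laplacian_mean:
      "\<And>V :: ('x::{finite,linorder}, 'y::{finite,linorder}) grid.
         grid_inner hx hy (grid_laplacian hx hy V) 1 = 0"
  shows
    "(\<forall>(Uold :: ('x, 'y) grid) Qold Unew Qnew.
        isotropic_AIQ_step hx hy s a b dt \<epsilon> \<beta> Uold Qold Unew Qnew \<longrightarrow>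
          grid_inner hx hy Unew 1 = grid_inner hx hy Uold 1) \<and>
     (\<forall>(chem :: ('x, 'y) chem_potential) Uold Yold Zold \<Phi>old Unew Ynew Znew \<Phi>new.
        anisotropic_AIQ_step hx hy s a b dt chem Uold Yold Zold \<Phi>old Unew Ynew Znew \<Phi>new \<longrightarrow>
          grid_inner hx hy Unew 1 = grid_inner hx hy Uold 1)"
proof -
  have mass: "grid_inner hx hy Unew 1 = grid_inner hx hy Uold 1"
    if "rk_update s b dt Uold K Unew"
      and "\<And>i. i \<in> {1..s} \<Longrightarrow> K i = grid_laplacian hx hy (\<mu> i)"
    for Uold Unew :: "('x, 'y) grid" and K \<mu>
    using rk_update_linear_invariant[OF linear_grid_inner_left that(1)] that(2) laplacian_mean
    by simp
  show ?thesis
  proof (intro conjI allI impI)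
    fix Uold Qold Unew Qnew :: "('x, 'y) grid"
    assume "isotropic_AIQ_step hx hy s a b dt \<epsilon> \<beta> Uold Qold Unew Qnew"
    then obtain K \<mu> where "rk_update s b dt Uold K Unew"
      and "\<forall>i\<in>{1..s}. K i = grid_laplacian hx hy (\<mu> i)"
      unfolding isotropic_AIQ_step_def by blast
    then show "grid_inner hx hy Unew 1 = grid_inner hx hy Uold 1"
      using mass by blast
  next
    fix chem :: "('x, 'y) chem_potential"
      and Uold :: "('x, 'y) grid" and Yold Zold \<Phi>old Unew Ynew Znew \<Phi>new
    assume "anisotropic_AIQ_step hx hy s a b dt chem Uold Yold Zold \<Phi>old Unew Ynew Znew \<Phi>new"
    then obtain K \<mu> where "rk_update s b dt Uold K Unew"
      and "\<forall>i\<in>{1..s}. K i = grid_laplacian hx hy (\<mu> i)"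
      unfolding anisotropic_AIQ_step_def by blast
    then show "grid_inner hx hy Unew 1 = grid_inner hx hy Uold 1"
      using mass by blast
  qed
qed

end
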